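(* Let $\mathcal{M}$ be a finite set of positive integers and $\delta:\mathcal{M}\to\mathbb{Z}$, $m\mapsto\delta_m$. Let $k_1,k_2>1$ be relatively prime integers and $k=k_1k_2$. Assume there is a positive integer $\ell$ with $\gcd(\ell,k)=1$ such that for every $m\in\mathcal{M}$ $$\ell\equiv\gcd(m,k_1)^2\pmod{\tfrac{k_2}{\gcd(m,k_2)}},\qquad \ell\equiv\gcd(m,k_2)^2\pmod{\tfrac{k_1}{\gcd(m,k_1)}}.$$ Let $\theta_1,\theta_2$ be positive integers with $\theta_1\theta_2=24$ and $\gcd(\theta_1k_1,\theta_2k_2)=1$, and let $n$ be an integer. Then there exist positive integers $n_1,n_2$ solving $$\ell(24n-u(k_1,k_2))\equiv24n_1k_2^2\pmod{\theta_1k_1},\qquad \ell(24n-u(k_1,k_2))\equiv24n_2k_1^2\pmod{\theta_2k_2},$$ and any such solutions satisfy $A_k(n)=A_{k_1}(n_1)A_{k_2}(n_2)$.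
   Context: Dedekind sums: for integers $a,b$ with $b>0$, $s(a,b)=\sum_{j=0}^{b-1}((j/b))((aj/b))$, where $((x))=x-\lfloor x\rfloor-1/2$ if $x\notin\mathbb{Z}$ and $((x))=0$ otherwise. For integers $k\ge1$ and $n$, $$A_k(n)=\sum_{\substack{0\le h<k\\ \gcd(h,k)=1}}\exp\!\Big(-2\pi i\Big(\tfrac{hn}{k}+\tfrac12\sum_{m\in\mathcal{M}}\delta_m\, s\big(\tfrac{mh}{\gcd(m,k)},\tfrac{k}{\gcd(m,k)}\big)\Big)\Big).$$ For relatively prime $k_1,k_2$, $$u(k_1,k_2)=\sum_{m\in\mathcal{M}}m\delta_m\Big(\tfrac{k_1^2}{\gcd(m,k_1)^2}+\tfrac{k_2^2}{\gcd(m,k_2)^2}-\tfrac{(k_1k_2)^2}{\gcd(m,k_1k_2)^2}-1\Big).$$ *)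

theory Defs
  imports Complex_Main "HOL-Number_Theory.Cong"
begin

definition sawtooth :: "real \<Rightarrow> real" where
  "sawtooth x = (if x \<in> \<int> then 0 else x - of_int \<lfloor>x\<rfloor> - 1 / 2)"

text \<open>Only used for \<open>b > 0\<close>; no coprimality of \<open>a\<close> and \<open>b\<close> is required.\<close>

definition dedekind_sum :: "int \<Rightarrow> int \<Rightarrow> real" where
  "dedekind_sum a b =
     (\<Sum>j\<in>{0..<b}. sawtooth (of_int j / of_int b) * sawtooth (of_int (a * j) / of_int b))"

text \<open>
  The map \<open>\<delta>\<close> from \<open>M\<close> to the integers is a total function of which only the values on \<open>M\<close> matter.
  All occurrences of \<open>div\<close> below are exact divisions.
\<close>

definition A_sum :: "int set \<Rightarrow> (int \<Rightarrow> int) \<Rightarrow> int \<Rightarrow> int \<Rightarrow> complex" where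
  "A_sum M \<delta> k n =
     (\<Sum>h | 0 \<le> h \<and> h < k \<and> gcd h k = 1.
        exp (- 2 * complex_of_real pi * \<i> *
          complex_of_real (of_int (h * n) / of_int k +
            1 / 2 * (\<Sum>m\<in>M. of_int (\<delta> m) * dedekind_sum (m * h div gcd m k) (k div gcd m k)))))"

definition u_sum :: "int set \<Rightarrow> (int \<Rightarrow> int) \<Rightarrow> int \<Rightarrow> int \<Rightarrow> int" where
  "u_sum M \<delta> k1 k2 =
     (\<Sum>m\<in>M. m * \<delta> m *
        (k1\<^sup>2 div (gcd m k1)\<^sup>2 + k2\<^sup>2 div (gcd m k2)\<^sup>2 - (k1 * k2)\<^sup>2 div (gcd m (k1 * k2))\<^sup>2 - 1))"

end

theory Submission
  imports Defs
begin

text \<open>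
  For coprime \<open>h\<close>, \<open>k\<close> the number \<open>12 k s(h, k)\<close> is an integer. Reciprocity, its residue modulo 3, and its
  residue modulo 8 for odd \<open>k\<close> (expressed by the Jacobi symbol) show that for pairwise coprime positive
  \<open>a\<close>, \<open>b\<close>, \<open>c\<close> the number \<open>s(c, ab) - s(bc, a) - s(ac, b) - c (a\<^sup>2 - 1)(b\<^sup>2 - 1) / (12 a b)\<close> is an
  even integer. With \<open>a = k\<^sub>1 / gcd(m, k\<^sub>1)\<close>, \<open>b = k\<^sub>2 / gcd(m, k\<^sub>2)\<close> and \<open>c = m h / gcd(m, k)\<close> the last
  fraction, weighted by \<open>\<delta>\<^sub>m\<close>, sums over \<open>m\<close> to \<open>- h u(k\<^sub>1, k\<^sub>2) / (12 k)\<close>. So the summand of \<open>A\<^sub>k(n)\<close> at \<open>h\<close> is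
  the product of the summands of the two factors at \<open>h\<^sub>1\<close> and \<open>h\<^sub>2\<close>, where \<open>l h\<^sub>1 \<equiv> h k\<^sub>2\<close> modulo \<open>k\<^sub>1\<close> and
  \<open>l h\<^sub>2 \<equiv> h k\<^sub>1\<close> modulo \<open>k\<^sub>2\<close>.
\<close>

section \<open>Integrality and reciprocity of Dedekind sums\<close>

lemma bij_betw_mult_mod:
  fixes h k :: int
  assumes "coprime h k" "k > 0"
  shows "bij_betw (\<lambda>j. h * j mod k) {0..<k} {0..<k}"
proof -
  have "inj_on (\<lambda>j. h * j mod k) {0..<k}"
  proof (rule inj_onI)
    fix x y assume xy: "x \<in> {0..<k}" "y \<in> {0..<k}" "h * x mod k = h * y mod k"
    then have "[x = y] (mod k)"
      using assms by (simp add: cong_def [symmetric] cong_mult_lcancel)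
    with xy show "x = y"
      by (auto simp: cong_def)
  qed
  moreover have "(\<lambda>j. h * j mod k) ` {0..<k} \<subseteq> {0..<k}"
    using assms by auto
  ultimately show ?thesis
    by (simp add: bij_betw_def endo_inj_surj)
qed

lemma sum_int_interval:
  fixes k :: int
  assumes "k \<ge> 0"
  shows "2 * (\<Sum>j\<in>{0..<k}. j) = k * (k - 1)"
  using assms
proof (induction k rule: int_ge_induct)
  case (step i)
  then have "{0..<i + 1} = insert i {0..<i}" by auto
  with step show ?case by (simp add: algebra_simps)
qed auto

lemma sum_int_interval_squares:
  fixes k :: int
  assumes "k \<ge> 0"
  shows "6 * (\<Sum>j\<in>{0..<k}. j\<^sup>2) = k * (k - 1) * (2 * k - 1)"
  using assms
proof (induction k rule: int_ge_induct)
  case (step i)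
  then have "{0..<i + 1} = insert i {0..<i}" by auto
  with step show ?case by (simp add: algebra_simps power2_eq_square)
qed auto

text \<open>The one ingredient of \<open>12 k s(h, k)\<close> that is not a polynomial in
  \<open>h\<close> and \<open>k\<close>.\<close>

definition floor_moment :: "int \<Rightarrow> int \<Rightarrow> int" where
  "floor_moment h k = (\<Sum>j\<in>{0..<k}. j * (h * j div k))"

text \<open>For coprime \<open>h\<close>, \<open>k\<close> with \<open>k > 0\<close> this is
  \<open>12 k s(h, k)\<close>. Residues are traded for quotients, so that integrality is built into
  the formula and divisibility questions stay inside the integers.\<close>

definition dedekind_int :: "int \<Rightarrow> int \<Rightarrow> int" where
  "dedekind_int h k = 2 * h * (k - 1) * (2 * k - 1) - 3 * k * (k - 1) - 12 * floor_moment h k"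

text \<open>Bridge from residues to quotients, needed both for the exact value of the Dedekind sum
  and for its residue modulo 8.\<close>

lemma sum_residue_product:
  fixes h k :: int
  shows "(\<Sum>j\<in>{0..<k}. j * (h * j mod k)) = h * (\<Sum>j\<in>{0..<k}. j\<^sup>2) - k * floor_moment h k"
  unfolding floor_moment_def sum_distrib_left sum_subtractf [symmetric]
  by (intro sum.cong refl) (simp add: minus_mult_div_eq_mod [symmetric] algebra_simps power2_eq_square)

lemma dedekind_sum_eq:
  assumes "coprime h k" "k > 0"
  shows "12 * of_int k * dedekind_sum h k = of_int (dedekind_int h k)"
proof -
  define r where "r j = h * j mod k" for j
  define K :: real where "K = of_int k"
  have K: "K > 0" using assms by (simp add: K_def)
  \<comment> \<open>The correction at \<open>j = 0\<close> is needed because the sawtooth function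
    vanishes at integers, whereas the polynomial expression gives
    \<open>(- 1 / 2)\<^sup>2 = 1 / 4\<close> there.\<close>
  have summand: "sawtooth (of_int j / of_int k) * sawtooth (of_int (h * j) / of_int k) =
      of_int (4 * (j * r j) - 2 * k * j - 2 * k * r j + k * k) / (4 * K * K) - (if j = 0 then 1 / 4 else 0)"
    if "j \<in> {0..<k}" for j
  proof (cases "j = 0")
    case True
    then show ?thesis using K by (simp add: sawtooth_def r_def K_def)
  next
    case False
    have saw: "sawtooth (of_int i / of_int k) = of_int (i mod k) / K - 1 / 2" if "\<not> k dvd i" for i
    proof -
      have "real_of_int i / of_int k \<notin> \<int>"
      proof
        assume "real_of_int i / of_int k \<in> \<int>"
        then obtain z where "real_of_int i / of_int k = of_int z" by (auto elim: Ints_cases)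
        then have "real_of_int i = of_int (k * z)" using assms by (simp add: field_simps)
        then have "i = k * z" by linarith
        with that show False by simp
      qed
      then show ?thesis using assms
        by (simp add: sawtooth_def floor_divide_of_int_eq K_def minus_mult_div_eq_mod [symmetric] field_simps)
    qed
    have nd: "\<not> k dvd j" using False that by (auto dest: zdvd_imp_le)
    then have "\<not> k dvd h * j" using assms
      by (simp add: coprime_commute coprime_dvd_mult_right_iff)
    have "j mod k = j" using that by simp
    show ?thesis
      unfolding saw [OF nd] saw [OF \<open>\<not> k dvd h * j\<close>] \<open>j mod k = j\<close>
      using K False by (simp add: r_def K_def field_simps)
  qed
  have "bij_betw r {0..<k} {0..<k}"
    unfolding r_def using assms by (rule bij_betw_mult_mod)
  then have sr: "(\<Sum>j\<in>{0..<k}. r j) = (\<Sum>j\<in>{0..<k}. j)"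
    using sum.reindex_bij_betw [of r _ _ "\<lambda>j. j"] by simp
  have prod: "(\<Sum>j\<in>{0..<k}. j * r j) = h * (\<Sum>j\<in>{0..<k}. j\<^sup>2) - k * floor_moment h k"
    unfolding r_def by (rule sum_residue_product)
  have "(\<Sum>j\<in>{0..<k}. 4 * (j * r j) - 2 * k * j - 2 * k * r j + k * k) =
      4 * (\<Sum>j\<in>{0..<k}. j * r j) - 2 * k * (\<Sum>j\<in>{0..<k}. j) - 2 * k * (\<Sum>j\<in>{0..<k}. r j) + k * k * k"
    using assms by (simp add: sum.distrib sum_subtractf sum_distrib_left)
  also have "3 * \<dots> = 2 * h * (6 * (\<Sum>j\<in>{0..<k}. j\<^sup>2)) - 12 * k * floor_moment h k
      - 6 * k * (2 * (\<Sum>j\<in>{0..<k}. j)) + 3 * k * k * k"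
    by (simp add: prod sr algebra_simps)
  also have "\<dots> = k * (dedekind_int h k + 3 * k)"
    unfolding sum_int_interval_squares [OF less_imp_le, OF \<open>k > 0\<close>] sum_int_interval [OF less_imp_le, OF \<open>k > 0\<close>]
    unfolding dedekind_int_def by algebra
  finally have *: "3 * (\<Sum>j\<in>{0..<k}. 4 * (j * r j) - 2 * k * j - 2 * k * r j + k * k) = k * (dedekind_int h k + 3 * k)" .
  have "dedekind_sum h k = of_int (\<Sum>j\<in>{0..<k}. 4 * (j * r j) - 2 * k * j - 2 * k * r j + k * k) / (4 * K * K) - 1 / 4"
    unfolding dedekind_sum_def using assms
    by (subst sum.cong [OF refl summand]) (auto simp: sum_subtractf sum_divide_distrib)
  then have "12 * K * dedekind_sum h k =
      of_int (3 * (\<Sum>j\<in>{0..<k}. 4 * (j * r j) - 2 * k * j - 2 * k * r j + k * k)) / K - 3 * K"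
    using K by (simp add: field_simps)
  also have "\<dots> = of_int (dedekind_int h k)"
    unfolding * using K by (simp add: K_def field_simps)
  finally show ?thesis by (simp add: K_def)
qed

lemma sum_double_interval:
  fixes q :: int
  assumes "q \<ge> 0"
  shows "q * (q + 1) = (\<Sum>i\<in>{1..q}. 2 * i)"
  using assms
proof (induction q rule: int_ge_induct)
  case (step i)
  then have "{1..i + 1} = insert (i + 1) {1..i}" by auto
  with step show ?case by (simp add: algebra_simps)
qed auto

lemma int_le_div_iff:
  fixes a b c :: int
  assumes "c > 0"
  shows "a \<le> b div c \<longleftrightarrow> a * c \<le> b"
proof
  assume "a \<le> b div c"
  with assms have "a * c \<le> b div c * c"
    by (intro mult_right_mono) simp_all
  also have "\<dots> \<le> b"
    using div_mult_mod_eq [of b c] pos_mod_sign [OF assms, of b] by linarith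
  finally show "a * c \<le> b" .
next
  assume "a * c \<le> b"
  with zdiv_mono1 [OF this assms] assms show "a \<le> b div c"
    by simp
qed

lemma int_div_less_iff:
  fixes a b c :: int
  assumes "c > 0"
  shows "b div c < a \<longleftrightarrow> b < a * c"
  using int_le_div_iff [OF assms, of a b] by linarith

text \<open>
  The residues \<open>h j mod k\<close> permute \<open>0, \<dots>, k - 1\<close>, so the sum of their squares is known; the sum of
  \<open>q (q + 1)\<close> over the quotients \<open>q = h j div k\<close> counts lattice points and exchanges \<open>h\<close> and \<open>k\<close>.
\<close>

lemma dedekind_reciprocity:
  assumes "coprime h k" "h > 0" "k > 0"
  shows "h * dedekind_int h k + k * dedekind_int k h = h\<^sup>2 + k\<^sup>2 + 1 - 3 * h * k"
proof -
  define q where "q j = h * j div k" for j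
  define r where "r j = h * j mod k" for j
  define S where "S = (\<Sum>j\<in>{0..<k}. j)"
  define S2 where "S2 = (\<Sum>j\<in>{0..<k}. j\<^sup>2)"
  have bij: "bij_betw r {0..<k} {0..<k}"
    unfolding r_def using assms by (intro bij_betw_mult_mod)
  have r: "r j = h * j - k * q j" for j
    by (simp add: r_def q_def minus_mult_div_eq_mod)
  have "(\<Sum>j\<in>{0..<k}. r j) = S"
    unfolding S_def using sum.reindex_bij_betw [OF bij, of "\<lambda>j. j"] by simp
  then have q1: "h * S - k * (\<Sum>j\<in>{0..<k}. q j) = S"
    by (simp add: r sum_subtractf sum_distrib_left S_def)
  have "(\<Sum>j\<in>{0..<k}. (r j)\<^sup>2) = S2"
    unfolding S2_def using sum.reindex_bij_betw [OF bij, of "\<lambda>j. j\<^sup>2"] by simp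
  moreover have "(r j)\<^sup>2 = h\<^sup>2 * j\<^sup>2 - 2 * h * k * (j * q j) + k\<^sup>2 * (q j)\<^sup>2" for j
    by (simp add: r power2_eq_square algebra_simps)
  ultimately have q2: "h\<^sup>2 * S2 - 2 * h * k * floor_moment h k + k\<^sup>2 * (\<Sum>j\<in>{0..<k}. (q j)\<^sup>2) = S2"
    by (simp add: sum_subtractf sum.distrib sum_distrib_left [symmetric] S2_def floor_moment_def q_def)
  have q0: "q j \<ge> 0" if "j \<in> {0..<k}" for j
    using that assms by (auto simp: q_def pos_imp_zdiv_nonneg_iff)
  have qh: "q j < h" if "j \<in> {0..<k}" for j
    using that assms by (simp add: q_def int_div_less_iff)
  have cnt: "card {j \<in> {0..<k}. i \<le> q j} = nat (k - 1 - k * i div h)" if "i \<in> {1..<h}" for i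
  proof -
    have "i \<le> q j \<longleftrightarrow> k * i div h < j" if j: "j \<in> {0..<k}" for j
    proof -
      \<comment> \<open>No lattice point lies on the diagonal, so the weak inequality
        \<open>i \<le> q j\<close> becomes the strict one \<open>k * i div h < j\<close>.\<close>
      have "k * i \<noteq> h * j"
      proof
        assume "k * i = h * j"
        then have "h dvd i"
          using assms by (metis coprime_dvd_mult_right_iff dvd_triv_left)
        with \<open>i \<in> {1..<h}\<close> show False by (auto dest: zdvd_imp_le)
      qed
      then show ?thesis
        using assms by (auto simp: q_def int_le_div_iff int_div_less_iff mult.commute)
    qed
    moreover have "k * i div h \<ge> 0"
      using that assms by (simp add: pos_imp_zdiv_nonneg_iff)
    ultimately have "{j \<in> {0..<k}. i \<le> q j} = {k * i div h + 1..<k}"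
      by auto
    then show ?thesis by simp
  qed
  have "(\<Sum>j\<in>{0..<k}. q j * (q j + 1)) = (\<Sum>j\<in>{0..<k}. \<Sum>i\<in>{1..q j}. 2 * i)"
    using sum_double_interval q0 by (intro sum.cong) auto
  also have "\<dots> = (\<Sum>j\<in>{0..<k}. \<Sum>i\<in>{i\<in>{1..<h}. i \<le> q j}. 2 * i)"
    using qh by (intro sum.cong) force+
  also have "\<dots> = (\<Sum>i\<in>{1..<h}. \<Sum>j\<in>{j\<in>{0..<k}. i \<le> q j}. 2 * i)"
    by (rule sum.swap_restrict) auto
  also have "\<dots> = (\<Sum>i\<in>{1..<h}. (k - 1) * (2 * i) - 2 * (i * (k * i div h)))"
  proof (intro sum.cong refl)
    fix i assume i: "i \<in> {1..<h}"
    then have "k * i div h \<le> k - 1"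
      using assms int_div_less_iff [of h "k * i" k] by simp
    then show "(\<Sum>j\<in>{j\<in>{0..<k}. i \<le> q j}. 2 * i) = (k - 1) * (2 * i) - 2 * (i * (k * i div h))"
      using cnt [OF i] by (simp add: algebra_simps)
  qed
  \<comment> \<open>The vanishing term \<open>i = 0\<close> is added so that the index set matches
    \<open>floor_moment k h\<close>.\<close>
  also have "\<dots> = (\<Sum>i\<in>{0..<h}. (k - 1) * (2 * i) - 2 * (i * (k * i div h)))"
    by (intro sum.mono_neutral_left) auto
  also have "\<dots> = (k - 1) * (2 * (\<Sum>i\<in>{0..<h}. i)) - 2 * floor_moment k h"
    by (simp add: sum_subtractf sum_distrib_left floor_moment_def)
  also have "2 * (\<Sum>i\<in>{0..<h}. i) = h * (h - 1)"
    using assms by (simp add: sum_int_interval)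
  finally have "(\<Sum>j\<in>{0..<k}. (q j)\<^sup>2) + (\<Sum>j\<in>{0..<k}. q j) = (k - 1) * (h * (h - 1)) - 2 * floor_moment k h"
    by (simp add: power2_eq_square algebra_simps sum.distrib)
  then have q3: "(\<Sum>j\<in>{0..<k}. (q j)\<^sup>2) = (k - 1) * (h * (h - 1)) - 2 * floor_moment k h - (\<Sum>j\<in>{0..<k}. q j)"
    by simp
  have S: "2 * S = k * (k - 1)" "6 * S2 = k * (k - 1) * (2 * k - 1)"
    using assms by (simp_all add: S_def S2_def sum_int_interval sum_int_interval_squares)
  define Q where "Q = (\<Sum>j\<in>{0..<k}. q j)"
  have "2 * (k * Q) = (h - 1) * (2 * S)"
    using q1 by (simp add: Q_def algebra_simps)
  also have "\<dots> = (h - 1) * (k * (k - 1))"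
    by (simp only: S)
  finally have Q: "2 * (k * Q) = (h - 1) * (k * (k - 1))" .
  \<comment> \<open>The sum of \<open>(q j)\<^sup>2\<close> is eliminated between \<open>q2\<close>,
    from squared residues, and \<open>q3\<close>, from lattice points. Every term carries a factor
    \<open>k\<close>, which is cancelled at the end.\<close>
  have "12 * h * k * floor_moment h k + 12 * k\<^sup>2 * floor_moment k h =
      (h\<^sup>2 - 1) * (6 * S2) + 6 * k\<^sup>2 * (k - 1) * (h * (h - 1)) - 3 * k * (2 * (k * Q))"
    using q2 unfolding q3 Q_def by (simp add: algebra_simps power2_eq_square)
  then have "k * (h * dedekind_int h k + k * dedekind_int k h) = k * (h\<^sup>2 + k\<^sup>2 + 1 - 3 * h * k)"
    unfolding S Q dedekind_int_def by (simp add: algebra_simps power2_eq_square)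
  with assms show ?thesis by simp
qed

lemma dedekind_sum_cong:
  assumes "k > 0" "[h = h'] (mod k)"
  shows "dedekind_sum h k = dedekind_sum h' k"
proof -
  have "sawtooth (of_int (h * j) / of_int k) = sawtooth (of_int (h' * j) / of_int k)" for j
  proof -
    obtain t where "h' = h + k * t"
      using assms(2) by (auto simp: cong_iff_lin)
    then have "real_of_int (h' * j) / of_int k = of_int (h * j) / of_int k + of_int (t * j)"
      using assms(1) by (simp add: field_simps)
    then show ?thesis
      by (simp add: sawtooth_def del: of_int_add of_int_mult)
  qed
  then show ?thesis
    by (simp add: dedekind_sum_def)
qed

text \<open>If \<open>k\<close> is 1 modulo 3, then 3 divides \<open>k - 1\<close>; if it is 2, then
  3 divides \<open>2 * k - 1\<close>. The other terms carry a factor 3 already.\<close>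

lemma three_dvd_dedekind_int:
  assumes "\<not> 3 dvd k"
  shows "3 dvd dedekind_int h k"
proof -
  have "3 dvd (k - 1) * (2 * k - 1)"
  proof (cases "3 dvd k - 1")
    case False
    with assms have "3 dvd 2 * k - 1" by presburger
    then show ?thesis by simp
  qed simp
  then have "3 dvd 2 * h * ((k - 1) * (2 * k - 1))"
    by (rule dvd_mult)
  moreover have "3 dvd 3 * (k * (k - 1) + 4 * floor_moment h k)"
    by simp
  moreover have "dedekind_int h k = 2 * h * ((k - 1) * (2 * k - 1)) - 3 * (k * (k - 1) + 4 * floor_moment h k)"
    by (simp add: dedekind_int_def algebra_simps)
  ultimately show ?thesis
    by (metis dvd_diff)
qed

section \<open>Residues modulo 8 and the Jacobi symbol\<close>

text \<open>
  For odd \<open>k\<close> coprime to \<open>h\<close> this is the Jacobi symbol \<open>(h/k)\<close>, in the form of Gauss's lemma for the half system of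
  odd residues: negation modulo \<open>k\<close> exchanges odd and even nonzero residues.
\<close>

definition gauss_sign :: "int \<Rightarrow> int \<Rightarrow> int" where
  "gauss_sign h k = (\<Prod>j | 0 < j \<and> j < k \<and> odd j. if odd (h * j mod k) then 1 else - 1)"

lemma finite_half_system: "finite {j :: int. 0 < j \<and> j < k \<and> odd j}"
  by (rule finite_subset [of _ "{0..k}"]) auto

text \<open>A factor \<open>- 1\<close> changes twice a product of signs by 4 modulo 8, just as its
  summand \<open>- 4\<close> changes the sum. This turns the product in \<open>gauss_sign\<close>
  into a sum comparable with Dedekind sums.\<close>

lemma prod_signs_cong:
  fixes f :: "'a \<Rightarrow> int"
  assumes "finite A" "\<And>x. x \<in> A \<Longrightarrow> f x = 1 \<or> f x = - 1"
  shows "((\<Prod>x\<in>A. f x) = 1 \<or> (\<Prod>x\<in>A. f x) = - 1) \<and>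
    [2 * (\<Prod>x\<in>A. f x) = 2 + (\<Sum>x\<in>A. 2 * (f x - 1))] (mod 8)"
  using assms
proof (induction A rule: finite_induct)
  case (insert x A)
  have "f x = 1 \<or> f x = - 1"
    using insert.prems by simp
  moreover from insert have "(\<Prod>x\<in>A. f x) = 1 \<or> (\<Prod>x\<in>A. f x) = - 1"
    "[2 * (\<Prod>x\<in>A. f x) = 2 + (\<Sum>x\<in>A. 2 * (f x - 1))] (mod 8)"
    by auto
  ultimately show ?case
    using insert.hyps by (elim disjE; simp add: cong_iff_dvd_diff del: sum_subtractf; presburger)
qed auto

lemma gauss_sign_cases: "gauss_sign h k = 1 \<or> gauss_sign h k = - 1"
  unfolding gauss_sign_def using prod_signs_cong [OF finite_half_system] by simp

lemma gauss_sign_cong: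
  "[h = h'] (mod k) \<Longrightarrow> gauss_sign h k = gauss_sign h' k"
  unfolding gauss_sign_def
  by (intro prod.cong refl) (metis cong_def cong_scalar_right)

text \<open>Multiplication by \<open>h'\<close>, followed by reflection of the even residues,
  permutes the half system. As \<open>k\<close> is odd, each reflection flips the parity of the
  residue after multiplication by \<open>h\<close>, and the flips are counted by the signs for
  \<open>h'\<close>.\<close>

lemma gauss_sign_mult:
  assumes "odd k" "coprime h k" "coprime h' k"
  shows "gauss_sign (h * h') k = gauss_sign h k * gauss_sign h' k"
proof -
  define H where "H = {j. 0 < j \<and> j < k \<and> odd j}"
  define \<sigma> where "\<sigma> j = (if odd (h' * j mod k) then h' * j mod k else k - h' * j mod k)" for j
  have fin: "finite H" unfolding H_def by (rule finite_half_system)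
  have nz: "x * j mod k > 0" "x * j mod k < k" if "coprime x k" "j \<in> H" for x j
  proof -
    have "\<not> k dvd j" using that by (auto simp: H_def dest: zdvd_imp_le)
    then have "\<not> k dvd x * j" using that
      by (simp add: coprime_commute coprime_dvd_mult_right_iff)
    moreover have "k > 0" using that by (simp add: H_def)
    ultimately show "x * j mod k > 0" "x * j mod k < k"
      using pos_mod_sign [of k "x * j"] pos_mod_bound [of k "x * j"] unfolding dvd_eq_mod_eq_0 by linarith+
  qed
  have "\<sigma> ` H \<subseteq> H"
    using nz [OF assms(3)] assms(1) by (force simp: \<sigma>_def H_def)
  moreover have "inj_on \<sigma> H"
  proof (rule inj_onI)
    fix x y assume xy: "x \<in> H" "y \<in> H" "\<sigma> x = \<sigma> y"
    \<comment> \<open>Up to a sign \<open>e\<close>, \<open>\<sigma>\<close> is multiplication by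
      the unit \<open>h'\<close>, so a collision of values means that \<open>k\<close> divides
      \<open>x - y\<close> or \<open>x + y\<close>.\<close>
    have sg: "\<exists>e. (e = 1 \<or> e = - 1) \<and> [\<sigma> j = h' * (e * j)] (mod k)" for j
    proof (cases "odd (h' * j mod k)")
      case True
      then show ?thesis by (intro exI [of _ 1]) (simp add: \<sigma>_def cong_def)
    next
      case False
      have "[k - h' * j mod k = 0 - h' * j] (mod k)"
        by (intro cong_diff) (simp_all add: cong_def)
      with False show ?thesis by (intro exI [of _ "- 1"]) (simp add: \<sigma>_def)
    qed
    from sg [of x] sg [of y] obtain e e' where e: "e = 1 \<or> e = - 1" "e' = 1 \<or> e' = - 1"
      and "[\<sigma> x = h' * (e * x)] (mod k)" "[\<sigma> y = h' * (e' * y)] (mod k)"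
      by blast
    with xy(3) have "[h' * (e * x) = h' * (e' * y)] (mod k)"
      by (metis cong_sym cong_trans)
    then have "[e * x = e' * y] (mod k)"
      using assms(3) by (simp only: cong_mult_lcancel)
    then have "k dvd e * x - e' * y"
      by (simp only: cong_iff_dvd_diff)
    then have "k dvd x - y \<or> k dvd x + y"
      using e dvd_minus_iff [of k "x - y"] dvd_minus_iff [of k "x + y"]
      by (elim disjE) (simp_all add: add.commute)
    then show "x = y"
    proof
      assume "k dvd x - y"
      with xy show ?thesis
        by (simp add: H_def mod_eq_dvd_iff [symmetric])
    next
      \<comment> \<open>The sum lies strictly between 0 and \<open>2 * k\<close>, so it would equal
        the odd number \<open>k\<close>, although \<open>x\<close> and \<open>y\<close> are both
        odd.\<close>
      assume "k dvd x + y"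
      then obtain c where c: "x + y = k * c" by auto
      moreover have "0 < k" "0 < x + y" "x + y < k * 2" using xy(1,2) by (simp_all add: H_def)
      ultimately have "0 < k" "0 < k * c" "k * c < k * 2" by simp_all
      then have "0 < c" "c < 2"
        using mult_less_cancel_left_pos [of k c 2] zero_less_mult_pos [of k c] by blast+
      then have "c = 1" by simp
      with c xy assms(1) have "odd (x + y)" by simp
      with xy show ?thesis by (simp add: H_def)
    qed
  qed
  ultimately have bij: "bij_betw \<sigma> H H"
    using fin by (simp add: bij_betw_def endo_inj_surj)
  define \<epsilon> :: "int \<Rightarrow> int" where "\<epsilon> x = (if odd (x mod k) then 1 else - 1)" for x
  have eq: "\<epsilon> (h * h' * j) = \<epsilon> (h * \<sigma> j) * \<epsilon> (h' * j)" if j: "j \<in> H" for j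
  proof (cases "odd (h' * j mod k)")
    case True
    then show ?thesis
      by (simp add: \<epsilon>_def \<sigma>_def mod_mult_right_eq mult.assoc)
  next
    case False
    have "coprime (h * h') k" using assms by simp
    from nz [OF this j] have "(- (h * h' * j)) mod k = k - h * h' * j mod k"
      by (simp add: zmod_zminus1_eq_if)
    moreover have "h * \<sigma> j mod k = (- (h * h' * j)) mod k"
    proof -
      have "[h * (k - h' * j mod k) = h * (0 - h' * j)] (mod k)"
        by (intro cong_mult cong_diff) (auto simp: cong_def)
      then show ?thesis using False by (simp add: \<sigma>_def cong_def mult.assoc)
    qed
    ultimately show ?thesis
      using False assms(1) by (simp add: \<epsilon>_def)
  qed
  have g: "gauss_sign x k = (\<Prod>j\<in>H. \<epsilon> (x * j))" for x
    by (simp add: gauss_sign_def H_def \<epsilon>_def)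
  have "gauss_sign (h * h') k = (\<Prod>j\<in>H. \<epsilon> (h * \<sigma> j)) * (\<Prod>j\<in>H. \<epsilon> (h' * j))"
    unfolding g prod.distrib [symmetric] by (intro prod.cong refl eq)
  also have "(\<Prod>j\<in>H. \<epsilon> (h * \<sigma> j)) = gauss_sign h k"
    unfolding g using prod.reindex_bij_betw [OF bij] .
  finally show ?thesis unfolding g .
qed

text \<open>Written as a sum, twice the sign becomes modulo 8 an expression in the sum of
  \<open>j * (h * j mod k)\<close>, which contains the same \<open>floor_moment\<close> as
  \<open>dedekind_int\<close>. What remains is a polynomial congruence.\<close>

lemma dedekind_int_mod_8:
  assumes "odd k" "k > 0"
  shows "[dedekind_int h k = k + 1 - 2 * gauss_sign h k] (mod 8)"
proof -
  let ?O = "{j. 0 < j \<and> j < k \<and> odd j}"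
  have "[2 * gauss_sign h k = 2 + (\<Sum>j\<in>?O. 2 * ((if odd (h * j mod k) then 1 else - 1) - 1))] (mod 8)"
    unfolding gauss_sign_def using prod_signs_cong [OF finite_half_system] by simp
  also have "(\<Sum>j\<in>?O. 2 * ((if odd (h * j mod k) then 1 else - 1) - 1 :: int)) =
      (\<Sum>j\<in>{0..<k}. if odd j then 2 * ((if odd (h * j mod k) then 1 else - 1) - 1) else 0)"
    by (subst sum.inter_filter [symmetric]) (auto intro!: sum.cong simp: order_less_le)
  \<comment> \<open>Both summands are multiples of 4, so only parities matter: each is 4 modulo 8
    exactly when \<open>j\<close> is odd and its residue is even.\<close>
  also have "[2 + \<dots> = 2 + (\<Sum>j\<in>{0..<k}. 4 * (j * (h * j mod k)) - 4 * j)] (mod 8)"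
  proof (intro cong_add cong_refl cong_sum)
    fix j
    show "[(if odd j then 2 * ((if odd (h * j mod k) then 1 else - 1) - 1) else 0)
        = 4 * (j * (h * j mod k)) - 4 * j] (mod 8)"
      by (auto elim!: evenE oddE simp: cong_iff_dvd_diff algebra_simps) 
  qed
  also have "(\<Sum>j\<in>{0..<k}. 4 * (j * (h * j mod k)) - 4 * j) =
      4 * (\<Sum>j\<in>{0..<k}. j * (h * j mod k)) - 2 * (2 * (\<Sum>j\<in>{0..<k}. j))"
    by (simp add: sum_subtractf sum_distrib_left)
  finally have 1: "[2 * gauss_sign h k = 2 + 4 * (h * (\<Sum>j\<in>{0..<k}. j\<^sup>2) - k * floor_moment h k) - 2 * (k * (k - 1))] (mod 8)"
    using assms by (simp add: sum_residue_product sum_int_interval add_diff_eq)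
  obtain t where t: "k = 2 * t + 1" using assms(1) by (auto elim: oddE)
  define S where "S = (\<Sum>j\<in>{0..<k}. j\<^sup>2)"
  have "3 * S = t * (2 * t + 1) * (4 * t + 1)"
    using sum_int_interval_squares [of k] assms(2) by (simp add: S_def t algebra_simps)
  \<comment> \<open>The sum of squares \<open>S\<close> has the parity of \<open>t\<close>, and
    \<open>t * (5 * t + 3)\<close> is even. These two facts raise the remaining multiples of 4 to
    multiples of 8.\<close>
  have "3 * S + t = 2 * (t * (4 * t * t + 3 * t + 1))"
    using \<open>3 * S = _\<close> by (simp add: algebra_simps)
  then have "even (3 * S + t)" by (metis dvd_triv_left)
  then have "even (S + t)" by simp
  then obtain w where w: "S = 2 * w - t" by (elim evenE) (metis add_diff_cancel_right')
  have "even (t * (5 * t + 3))" by simp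
  then obtain v where v: "t * (5 * t + 3) = 2 * v" by (elim evenE)
  from 1 have "[2 + 4 * (h * S - k * floor_moment h k) - 2 * (k * (k - 1)) = 2 * gauss_sign h k] (mod 8)"
    unfolding S_def by (rule cong_sym)
  then obtain z where "2 * gauss_sign h k = 2 + 4 * (h * S - k * floor_moment h k) - 2 * (k * (k - 1)) + 8 * z"
    by (elim cong_iff_lin [THEN iffD1, THEN exE])
  then have "dedekind_int h k - (k + 1 - 2 * gauss_sign h k) =
      8 * (h * w + 2 * h * t * t - 2 * floor_moment h k - t * floor_moment h k + z) - 4 * (t * (5 * t + 3))"
    by (simp add: dedekind_int_def t w algebra_simps)
  then show ?thesis
    unfolding v cong_iff_dvd_diff by simp
qed

section \<open>Squares modulo 3, 8 and 24\<close>

lemma three_dvd_square_minus_one: "\<not> 3 dvd a \<Longrightarrow> 3 dvd a\<^sup>2 - 1" for a :: int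
proof -
  assume "\<not> 3 dvd a"
  then have "3 dvd a - 1 \<or> 3 dvd a + 1" by presburger
  then have "3 dvd (a - 1) * (a + 1)" by auto
  then show ?thesis by (simp add: algebra_simps power2_eq_square)
qed

lemma eight_dvd_square_minus_one: "odd a \<Longrightarrow> 8 dvd a\<^sup>2 - 1" for a :: int
proof -
  assume "odd a"
  then obtain t where "a = 2 * t + 1" by (elim oddE)
  moreover have "even (t * (t + 1))" by simp
  then obtain v where "t * (t + 1) = 2 * v" by (elim evenE)
  ultimately have "a\<^sup>2 - 1 = 8 * v"
    by (simp add: algebra_simps power2_eq_square)
  then show ?thesis by simp
qed

lemma twenty_four_dvdI:
  fixes y :: int
  assumes "3 dvd y" "8 dvd y"
  shows "24 dvd y"
proof -
  have "coprime 3 (2 ^ 3 :: int)" by (simp only: coprime_power_right_iff) simp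
  then have "3 * 8 dvd y" using assms by (intro divides_mult) simp_all
  then show ?thesis by simp
qed

text \<open>Neither 2 nor 3 divides both numbers, so for each of these primes one of the two factors
  supplies the required divisor. This makes \<open>u_sum\<close> a multiple of 24.\<close>

lemma twenty_four_dvd:
  fixes a b :: int
  assumes "coprime a b"
  shows "24 dvd (a\<^sup>2 - 1) * (b\<^sup>2 - 1)"
proof -
  have two: "\<not> (p dvd a \<and> p dvd b)" if "prime p" for p
    using assms that by (meson coprime_common_divisor not_prime_unit)
  have "3 dvd (a\<^sup>2 - 1) * (b\<^sup>2 - 1)"
    using two [of 3] three_dvd_square_minus_one [of a] three_dvd_square_minus_one [of b]
    by (cases "3 dvd a") simp_all
  moreover have "8 dvd (a\<^sup>2 - 1) * (b\<^sup>2 - 1)"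
    using two [of 2] eight_dvd_square_minus_one [of a] eight_dvd_square_minus_one [of b]
    by (cases "even a") simp_all
  ultimately show ?thesis by (rule twenty_four_dvdI)
qed

section \<open>Quadratic reciprocity from Dedekind reciprocity\<close>

lemma odd_cong_4_cases:
  fixes a :: int
  assumes "odd a"
  shows "[a = 1] (mod 4) \<or> [a = 3] (mod 4)"
proof -
  obtain t where "a = 2 * t + 1"
    using assms by (elim oddE)
  then show ?thesis
    by (cases "even t") (auto simp: cong_iff_dvd_diff elim!: evenE oddE)
qed

text \<open>Dedekind reciprocity read modulo 8, with \<open>a\<^sup>2\<close> and
  \<open>b\<^sup>2\<close> replaced by 1.\<close>

lemma gauss_sign_reciprocity_mod_8:
  assumes "coprime a b" "a > 0" "b > 0" "odd a" "odd b"
  shows "[2 * b * gauss_sign b a + 2 * a * gauss_sign a b = 5 * a * b + a + b - 3] (mod 8)"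
proof -
  have "[b * dedekind_int b a + a * dedekind_int a b =
      b * (a + 1 - 2 * gauss_sign b a) + a * (b + 1 - 2 * gauss_sign a b)] (mod 8)"
    using assms by (intro cong_add cong_mult cong_refl dedekind_int_mod_8)
  moreover have "b * dedekind_int b a + a * dedekind_int a b = a\<^sup>2 + b\<^sup>2 + 1 - 3 * a * b"
    using dedekind_reciprocity [of a b] assms by simp
  moreover have "8 dvd a\<^sup>2 - 1" "8 dvd b\<^sup>2 - 1"
    using assms by (simp_all add: eight_dvd_square_minus_one)
  moreover have "2 * b * gauss_sign b a + 2 * a * gauss_sign a b - (5 * a * b + a + b - 3) =
      (a\<^sup>2 + b\<^sup>2 + 1 - 3 * a * b - (b * (a + 1 - 2 * gauss_sign b a) + a * (b + 1 - 2 * gauss_sign a b)))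
        - (a\<^sup>2 - 1) - (b\<^sup>2 - 1)"
    by (simp add: algebra_simps)
  ultimately show ?thesis
    unfolding cong_iff_dvd_diff by (simp only: dvd_diff)
qed

text \<open>Quadratic reciprocity for the Jacobi symbol. The congruence modulo 8 depends only on
  \<open>a\<close> and \<open>b\<close> modulo 4, which leaves finitely many cases.\<close>

lemma gauss_sign_reciprocity:
  assumes "coprime a b" "a > 0" "b > 0" "odd a" "odd b"
  shows "gauss_sign a b = (if [a = 3] (mod 4) \<and> [b = 3] (mod 4) then - gauss_sign b a else gauss_sign b a)"
proof -
  define p where "p = gauss_sign b a"
  define q where "q = gauss_sign a b"
  have split: "\<exists>s i. x = 4 * s + (2 * i + 1) \<and> (i = 0 \<or> i = 1) \<and> ([x = 3] (mod 4) \<longleftrightarrow> i = 1)"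
    if "odd x" for x :: int
    using odd_cong_4_cases [OF that]
  proof
    assume "[x = 1] (mod 4)"
    then show ?thesis
      using mult_div_mod_eq [of 4 x]
      by - (rule exI [of _ "x div 4"], rule exI [of _ 0], simp add: cong_def)
  next
    assume "[x = 3] (mod 4)"
    then show ?thesis
      using mult_div_mod_eq [of 4 x]
      by - (rule exI [of _ "x div 4"], rule exI [of _ 1], simp add: cong_def)
  qed
  obtain s i where a: "a = 4 * s + (2 * i + 1)" "i = 0 \<or> i = 1" "[a = 3] (mod 4) \<longleftrightarrow> i = 1"
    using split [OF assms(4)] by blast
  obtain t j where b: "b = 4 * t + (2 * j + 1)" "j = 0 \<or> j = 1" "[b = 3] (mod 4) \<longleftrightarrow> j = 1"
    using split [OF assms(5)] by blast
  have "8 dvd 2 * b * p + 2 * a * q - (5 * a * b + a + b - 3)"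
    using gauss_sign_reciprocity_mod_8 [OF assms] by (simp add: p_def q_def cong_iff_dvd_diff)
  \<comment> \<open>The subtracted multiple of 8 is the exact effect of replacing \<open>a\<close>
    by \<open>2 * i + 1\<close> and \<open>b\<close> by \<open>2 * j + 1\<close>.\<close>
  moreover have "8 dvd 8 * (t * p + s * q - 10 * s * t - t * (5 * i + 3) - s * (5 * j + 3))"
    by simp
  ultimately have "8 dvd (2 * b * p + 2 * a * q - (5 * a * b + a + b - 3)) -
      8 * (t * p + s * q - 10 * s * t - t * (5 * i + 3) - s * (5 * j + 3))"
    by (rule dvd_diff)
  also have "\<dots> = 2 * (2 * j + 1) * p + 2 * (2 * i + 1) * q - (5 * (2 * i + 1) * (2 * j + 1) + 2 * i + 2 * j - 1)"
    by (simp add: a(1) b(1) algebra_simps)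
  finally have "q = (if i = 1 \<and> j = 1 then - p else p)"
    using a(2) b(2) gauss_sign_cases [of a b] gauss_sign_cases [of b a]
    unfolding p_def [symmetric] q_def [symmetric] by (elim disjE) simp_all
  then show ?thesis
    using a(3) b(3) by (simp add: p_def q_def)
qed

text \<open>Reciprocity moves the product into the upper argument, after \<open>c\<close> has been made odd by adding \<open>a b\<close>.\<close>

lemma gauss_sign_mult_lower:
  assumes "odd a" "odd b" "a > 0" "b > 0" "coprime c (a * b)" "c > 0"
  shows "gauss_sign c (a * b) = gauss_sign c a * gauss_sign c b"
proof -
  define d where "d = (if odd c then c else c + a * b)"
  have d: "odd d" "d > 0" "[c = d] (mod a * b)" "[c = d] (mod a)" "[c = d] (mod b)"
    using assms by (auto simp: d_def cong_iff_lin add_pos_pos)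
  then have "coprime d (a * b)"
    using assms(5) by (metis cong_imp_coprime)
  then have cop: "coprime d a" "coprime d b" "coprime a d" "coprime b d" "coprime d (a * b)"
    by (auto simp: coprime_commute)
  have 4: "[x = 3] (mod 4) \<longleftrightarrow> \<not> [x = 1] (mod 4)" if "odd x" for x :: int
    using odd_cong_4_cases [OF that] by (auto simp: cong_def)
  have ab: "[a * b = 3] (mod 4) \<longleftrightarrow> ([a = 3] (mod 4) \<longleftrightarrow> [b = 1] (mod 4))"
    using odd_cong_4_cases [OF assms(1)] odd_cong_4_cases [OF assms(2)]
      mod_mult_eq [of a 4 b] by (elim disjE) (simp_all add: cong_def)
  have "gauss_sign d (a * b) = gauss_sign d a * gauss_sign d b"
    using gauss_sign_reciprocity [of d "a * b"] gauss_sign_reciprocity [of d a]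
      gauss_sign_reciprocity [of d b] gauss_sign_mult [of d a b] assms d cop ab 4 [of a] 4 [of b]
    by auto
  then show ?thesis
    using d(3-5) [THEN gauss_sign_cong] by simp
qed

section \<open>Dedekind sums to a composite modulus\<close>

text \<open>For pairwise coprime positive arguments this is \<open>12 a b\<close> times the number
  \<open>s(c, ab) - s(bc, a) - s(ac, b) - c (a\<^sup>2 - 1)(b\<^sup>2 - 1) / (12 a b)\<close>. That
  number is an even integer exactly when \<open>24 a b\<close> divides the defect.\<close>

definition defect :: "int \<Rightarrow> int \<Rightarrow> int \<Rightarrow> int" where
  "defect a b c = dedekind_int c (a * b) - b * dedekind_int (b * c) a - a * dedekind_int (a * c) b
     - c * (a\<^sup>2 - 1) * (b\<^sup>2 - 1)"

text \<open>Reciprocity replaces \<open>dedekind_int c (a * b)\<close> by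
  \<open>dedekind_int (a * b) c\<close>. The term with
  \<open>(a\<^sup>2 - 1) * (b\<^sup>2 - 1)\<close> then completes the polynomial part to a symmetric
  one.\<close>

lemma mult_defect:
  assumes "coprime a b" "coprime a c" "coprime b c" "a > 0" "b > 0" "c > 0"
  shows "c * defect a b c = a\<^sup>2 * b\<^sup>2 + b\<^sup>2 * c\<^sup>2 + c\<^sup>2 * a\<^sup>2 + 1 - 3 * a * b * c - a\<^sup>2 * b\<^sup>2 * c\<^sup>2
    - (a * b * dedekind_int (a * b) c + b * c * dedekind_int (b * c) a + c * a * dedekind_int (c * a) b)"
proof -
  have "c * dedekind_int c (a * b) = c\<^sup>2 + (a * b)\<^sup>2 + 1 - 3 * c * (a * b) - a * b * dedekind_int (a * b) c"
    using dedekind_reciprocity [of c "a * b"] assms by (simp add: coprime_commute)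
  then show ?thesis
    by (simp add: defect_def algebra_simps power2_eq_square)
qed

lemma three_dvd_defect:
  assumes "\<not> 3 dvd a" "\<not> 3 dvd b"
  shows "3 dvd defect a b c"
  unfolding defect_def
  using assms three_dvd_square_minus_one [of a] three_dvd_dedekind_int
  by (intro dvd_diff) (auto simp: prime_dvd_mult_iff)

text \<open>Modulo 8 all three Dedekind terms are expressed by the signs of \<open>c\<close> and of
  \<open>a\<close>, \<open>b\<close> against each other, and the reciprocity congruence ties the
  latter two together.\<close>

lemma eight_dvd_defect:
  assumes "odd a" "odd b" "coprime a b" "coprime a c" "coprime b c" "a > 0" "b > 0" "c > 0"
  shows "8 dvd defect a b c"
proof -
  let ?u = "gauss_sign c a" and ?v = "gauss_sign c b" and ?p = "gauss_sign b a" and ?q = "gauss_sign a b"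
  have "[dedekind_int c (a * b) = a * b + 1 - 2 * gauss_sign c (a * b)] (mod 8)"
    "[dedekind_int (b * c) a = a + 1 - 2 * gauss_sign (b * c) a] (mod 8)"
    "[dedekind_int (a * c) b = b + 1 - 2 * gauss_sign (a * c) b] (mod 8)"
    using assms by (auto intro!: dedekind_int_mod_8)
  moreover have "gauss_sign c (a * b) = ?u * ?v" "gauss_sign (b * c) a = ?p * ?u" "gauss_sign (a * c) b = ?q * ?v"
    using assms by (simp_all add: gauss_sign_mult_lower gauss_sign_mult coprime_commute)
  moreover have "[c * (a\<^sup>2 - 1) * (b\<^sup>2 - 1) = 0] (mod 8)"
    using eight_dvd_square_minus_one [OF assms(1)] by (simp add: cong_0_iff)
  ultimately have *: "[defect a b c = (a * b + 1 - 2 * (?u * ?v)) - b * (a + 1 - 2 * (?p * ?u)) - a * (b + 1 - 2 * (?q * ?v)) - 0] (mod 8)"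
    unfolding defect_def by (intro cong_diff cong_mult cong_refl) auto
  have "[2 * b * ?p + 2 * a * ?q = 5 * a * b + a + b - 3] (mod 8)"
    using assms by (intro gauss_sign_reciprocity_mod_8)
  then obtain z where z: "2 * b * ?p + 2 * a * ?q = 5 * a * b + a + b - 3 + 8 * z"
    by (auto simp: cong_iff_dvd_diff algebra_simps elim: dvdE)
  have odd_sign: "odd (gauss_sign x y)" for x y
    using gauss_sign_cases [of x y] by auto
  have "even (a * b - 1)" "even (b - ?q)" "even (a - ?p)" "even (a - 1)" "even (b - 1)"
    using assms odd_sign by simp_all
  then obtain w x y s t where w: "a * b - 1 = 2 * w" "b - ?q = 2 * x" "a - ?p = 2 * y" "a - 1 = 2 * s" "b - 1 = 2 * t"
    by (elim evenE)
  let ?e = "(a * b + 1 - 2 * (?u * ?v)) - b * (a + 1 - 2 * (?p * ?u)) - a * (b + 1 - 2 * (?q * ?v))"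
  have e: "?e = 1 - a * b - a - b - 2 * ?u * ?v + ?u * (2 * b * ?p) + ?v * (2 * a * ?q)"
    by (simp add: algebra_simps)
  \<comment> \<open>For equal signs the reciprocity congruence applies directly. For opposite signs
    it leaves an extra \<open>4 * a * ?q\<close> or \<open>4 * b * ?p\<close>, which is absorbed
    because all the signs are odd.\<close>
  consider "?u = 1" "?v = 1" | "?u = - 1" "?v = - 1" | "?u = 1" "?v = - 1" | "?u = - 1" "?v = 1"
    using gauss_sign_cases [of c a] gauss_sign_cases [of c b] by blast
  then have "8 dvd ?e"
  proof cases
    case 1
    with e z have "?e = 4 * (a * b - 1) + 8 * z" by simp
    then show ?thesis by (simp add: w)
  next
    case 2
    with e z have "?e = 2 * ((a - 1) * (b - 1)) - 8 * (a * b) - 8 * z" by (simp add: algebra_simps)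
    also have "\<dots> = 8 * (s * t - a * b - z)" by (simp only: w) (simp add: algebra_simps)
    finally show ?thesis by (simp only: dvd_triv_left)
  next
    case 3
    with e z have "?e = 4 * (a * (b - ?q)) + 8 * z" by (simp add: algebra_simps)
    then show ?thesis by (simp add: w)
  next
    case 4
    with e z have "?e = 4 * (b * (a - ?p)) + 8 * z" by (simp add: algebra_simps)
    then show ?thesis by (simp add: w)
  qed
  with * show ?thesis by (simp add: cong_dvd_iff)
qed

text \<open>
  By \<open>mult_defect\<close> the product \<open>c * defect a b c\<close> is symmetric, hence \<open>a b c y\<close> for some \<open>y\<close>. As two of \<open>a\<close>, \<open>b\<close>, \<open>c\<close> are
  prime to 3 and two are odd, rotating the arguments shows that 3 and 8 divide \<open>y\<close>.
\<close>

lemma mult_dvd_defect: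
  assumes "coprime a b" "coprime a c" "coprime b c" "a > 0" "b > 0" "c > 0"
  shows "24 * (a * b) dvd defect a b c"
proof -
  have rot: "c * defect a b c = a * defect b c a" "c * defect a b c = b * defect c a b"
    using assms by (simp_all add: mult_defect coprime_commute algebra_simps)
  have "a dvd c * defect a b c"
    unfolding rot(1) by simp
  moreover have "b dvd c * defect a b c"
    unfolding rot(2) by simp
  ultimately have "a * b dvd c * defect a b c"
    using assms(1) by (rule divides_mult)
  then have "a * b dvd defect a b c"
    using assms by (simp add: coprime_dvd_mult_right_iff)
  then obtain y where y: "defect a b c = a * b * y" ..
  have "a * defect b c a = c * (a * b * y)" "b * defect c a b = c * (a * b * y)"
    by (simp_all only: rot [symmetric] y)
  \<comment> \<open>Cancelling the leading factor shows that the same \<open>y\<close> serves all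
    three rotations.\<close>
  then have "a * (defect b c a - b * c * y) = 0" "b * (defect c a b - c * a * y) = 0"
    by (simp_all add: algebra_simps)
  with assms have y': "defect b c a = b * c * y" "defect c a b = c * a * y"
    by simp_all
  have three: "3 dvd a * b * z \<Longrightarrow> \<not> 3 dvd a \<Longrightarrow> \<not> 3 dvd b \<Longrightarrow> 3 dvd z" for a b z :: int
    by (simp add: prime_dvd_mult_iff)
  have eight: "8 dvd a * b * z \<Longrightarrow> odd a \<Longrightarrow> odd b \<Longrightarrow> 8 dvd z" for a b z :: int
  proof -
    assume "8 dvd a * b * z" "odd a" "odd b"
    moreover from this have "coprime (2 ^ 3) (a * b)" by (simp only: coprime_power_left_iff) simp
    ultimately show "8 dvd z" by (simp add: coprime_dvd_mult_right_iff)
  qed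
  have two: "\<not> (p dvd a \<and> p dvd b)" "\<not> (p dvd b \<and> p dvd c)" "\<not> (p dvd c \<and> p dvd a)" if "prime p" for p
    using assms(1-3) that by (meson coprime_common_divisor not_prime_unit)+
  have "3 dvd y"
  proof -
    consider "\<not> 3 dvd a" "\<not> 3 dvd b" | "\<not> 3 dvd b" "\<not> 3 dvd c" | "\<not> 3 dvd c" "\<not> 3 dvd a"
      using two [of 3] by auto
    then show ?thesis
    proof cases
      case 1
      with three_dvd_defect [of a b c] three [of a b y] y show ?thesis by simp
    next
      case 2
      with three_dvd_defect [of b c a] three [of b c y] y' show ?thesis by simp
    next
      case 3
      with three_dvd_defect [of c a b] three [of c a y] y' show ?thesis by simp
    qed
  qed
  moreover have "8 dvd y"
  proof -
    consider "odd a" "odd b" | "odd b" "odd c" | "odd c" "odd a"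
      using two [of 2] by auto
    then show ?thesis
    proof cases
      case 1
      with eight_dvd_defect [of a b c] eight [of a b y] y assms show ?thesis by simp
    next
      case 2
      with eight_dvd_defect [of b c a] eight [of b c y] y' assms show ?thesis by (simp add: coprime_commute)
    next
      case 3
      with eight_dvd_defect [of c a b] eight [of c a y] y' assms show ?thesis by (simp add: coprime_commute)
    qed
  qed
  ultimately have "24 dvd y" by (rule twenty_four_dvdI)
  then show ?thesis
    unfolding y by (simp add: mult.commute [of 24] mult_dvd_mono)
qed

text \<open>Division of the defect by \<open>12 * a * b\<close>. The integer must be even because
  the exponential sums weight Dedekind sums by 1/2.\<close>

lemma dedekind_sum_mult_cong:
  assumes "coprime a b" "coprime a c" "coprime b c" "a > 0" "b > 0" "c > 0"
  obtains z :: int where "dedekind_sum c (a * b) =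
    dedekind_sum (b * c) a + dedekind_sum (a * c) b + of_int (c * (a\<^sup>2 - 1) * (b\<^sup>2 - 1)) / (12 * of_int (a * b)) + 2 * of_int z"
proof -
  from mult_dvd_defect [OF assms] obtain z where z: "defect a b c = 24 * (a * b) * z" ..
  have pos: "0 < real_of_int a" "0 < real_of_int b" using assms by simp_all
  have "12 * of_int (a * b) * dedekind_sum c (a * b) = of_int (dedekind_int c (a * b))"
    "12 * of_int a * dedekind_sum (b * c) a = of_int (dedekind_int (b * c) a)"
    "12 * of_int b * dedekind_sum (a * c) b = of_int (dedekind_int (a * c) b)"
    using assms by (intro dedekind_sum_eq; simp add: coprime_commute)+
  then have I: "dedekind_sum c (a * b) = of_int (dedekind_int c (a * b)) / (12 * (of_int a * of_int b))"
    "dedekind_sum (b * c) a = of_int (dedekind_int (b * c) a) / (12 * of_int a)"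
    "dedekind_sum (a * c) b = of_int (dedekind_int (a * c) b) / (12 * of_int b)"
    using pos by (simp_all add: field_simps)
  have "dedekind_int c (a * b) = b * dedekind_int (b * c) a + a * dedekind_int (a * c) b
     + c * (a\<^sup>2 - 1) * (b\<^sup>2 - 1) + 24 * (a * b) * z"
    unfolding z [symmetric] by (simp add: defect_def)
  then have "dedekind_sum c (a * b) = of_int (b * dedekind_int (b * c) a + a * dedekind_int (a * c) b
     + c * (a\<^sup>2 - 1) * (b\<^sup>2 - 1) + 24 * (a * b) * z) / (12 * (of_int a * of_int b))"
    using I(1) by (simp only:)
  then have "dedekind_sum c (a * b) = dedekind_sum (b * c) a + dedekind_sum (a * c) b
     + of_int (c * (a\<^sup>2 - 1) * (b\<^sup>2 - 1)) / (12 * of_int (a * b)) + 2 * of_int z"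
    unfolding I(2,3) of_int_add of_int_mult [of b] of_int_mult [of a] of_int_mult [of 24] of_int_mult [of "24 * (a * b)"]
    using pos by (simp add: add_divide_distrib)
  then show ?thesis by (rule that)
qed

section \<open>Splitting the Dedekind sums attached to \<open>m\<close>\<close>

lemma gcd_mult_coprime:
  fixes k1 k2 m :: int
  assumes "coprime k1 k2"
  shows "gcd m (k1 * k2) = gcd m k1 * gcd m k2"
proof (rule zdvd_antisym_nonneg)
  obtain x y where xy: "gcd m (k1 * k2) = x * y" "x dvd k1" "y dvd k2"
    using division_decomp [of "gcd m (k1 * k2)" k1 k2] by auto
  have "x dvd m" "y dvd m"
    by (metis dvd_mult_left dvd_mult_right gcd_dvd1 xy(1))+
  with xy show "gcd m (k1 * k2) dvd gcd m k1 * gcd m k2"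
    by (simp add: mult_dvd_mono)
  have "coprime (gcd m k1) (gcd m k2)"
    using assms by (meson coprime_divisors gcd_dvd2)
  then show "gcd m k1 * gcd m k2 dvd gcd m (k1 * k2)"
    by (simp add: divides_mult mult_dvd_mono)
qed auto

text \<open>With \<open>g1\<close>, \<open>g2\<close> the gcds of \<open>m\<close> with
  \<open>k1\<close>, \<open>k2\<close>, the first argument on the right is
  \<open>m' * g2 * h1\<close>, which has to agree with \<open>b * m' * h\<close> modulo
  \<open>a\<close>. Since \<open>l\<close> is \<open>g2\<^sup>2\<close> there, the congruence for
  \<open>h1\<close> gives this after cancelling \<open>g2\<close>; the second factor is
  analogous.\<close>

lemma dedekind_sum_split:
  fixes m k1 k2 h h1 h2 l :: int
  assumes pos: "m > 0" "k1 > 0" "k2 > 0" "h > 0"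
    and cop: "coprime k1 k2" "coprime h (k1 * k2)"
    and l: "[l = (gcd m k1)\<^sup>2] (mod (k2 div gcd m k2))" "[l = (gcd m k2)\<^sup>2] (mod (k1 div gcd m k1))"
    and h: "[l * h1 = h * k2] (mod k1)" "[l * h2 = h * k1] (mod k2)"
  shows "\<exists>z. dedekind_sum (m * h div gcd m (k1 * k2)) (k1 * k2 div gcd m (k1 * k2)) =
    dedekind_sum (m * h1 div gcd m k1) (k1 div gcd m k1) + dedekind_sum (m * h2 div gcd m k2) (k2 div gcd m k2)
    + of_int (h * (m * (((k1 div gcd m k1)\<^sup>2 - 1) * ((k2 div gcd m k2)\<^sup>2 - 1)))) / (12 * of_int (k1 * k2)) + 2 * of_int z"
proof -
  define g1 g2 where "g1 = gcd m k1" and "g2 = gcd m k2"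
  define a b where "a = k1 div g1" and "b = k2 div g2"
  have g: "gcd m (k1 * k2) = g1 * g2"
    using cop(1) by (simp add: gcd_mult_coprime g1_def g2_def)
  have gpos: "g1 > 0" "g2 > 0" using pos by (simp_all add: g1_def g2_def)
  have k: "k1 = g1 * a" "k2 = g2 * b" by (simp_all add: a_def b_def g1_def g2_def)
  define m' where "m' = m div (g1 * g2)"
  have m: "m = g1 * g2 * m'"
    unfolding m'_def g [symmetric] by simp
  have ab: "a > 0" "b > 0" "m' > 0"
    using pos gpos unfolding k m by (auto simp: zero_less_mult_iff mult_less_0_iff)
  have "k1 * k2 div (g1 * g2) = a * b"
    using gpos unfolding k by (simp add: ac_simps)
  then have "coprime m' (a * b)"
    using div_gcd_coprime [of m "k1 * k2"] pos unfolding g m'_def by simp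
  moreover have "coprime a b" "coprime h a" "coprime h b" "coprime g2 a" "coprime g1 b"
    using cop unfolding k by (simp_all add: coprime_commute)
  ultimately have c: "coprime a b" "coprime a (m' * h)" "coprime b (m' * h)" "coprime g2 a" "coprime g1 b"
    by (simp_all add: coprime_commute)
  \<comment> \<open>Stated once for both factors: \<open>p\<close> and \<open>c\<close> are the gcd
    and quotient of the modulus concerned, \<open>q\<close> and \<open>d\<close> those of the other
    one.\<close>
  have reduce: "dedekind_sum (m * x div p) c = dedekind_sum (d * (m' * h)) c"
    if "g1 * g2 = p * q" "p > 0" "c > 0" "coprime q c" "[l * x = h * (q * d)] (mod p * c)" "[l = q\<^sup>2] (mod c)"
    for x p q c d
  proof -
    have "[l * x = h * (q * d)] (mod c)"
      using that(5) by (rule cong_dvd_modulus) simp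
    moreover have "[q\<^sup>2 * x = l * x] (mod c)"
      using that(6) by (intro cong_scalar_right) (rule cong_sym)
    ultimately have "[q * (q * x) = q * (d * h)] (mod c)"
      by (simp add: power2_eq_square ac_simps) (metis cong_trans)
    then have "[m' * (q * x) = m' * (d * h)] (mod c)"
      using that(4) by (simp add: cong_mult_lcancel cong_scalar_left)
    moreover have "m * x div p = m' * (q * x)"
      using that(2) unfolding m that(1) by (simp add: ac_simps)
    ultimately show ?thesis
      using that(3) by (intro dedekind_sum_cong) (simp_all add: ac_simps)
  qed
  have A: "dedekind_sum (m * h1 div g1) a = dedekind_sum (b * (m' * h)) a"
  proof (rule reduce [OF refl])
    show "[l * h1 = h * (g2 * b)] (mod g1 * a)" using h(1) unfolding k .
    show "[l = g2\<^sup>2] (mod a)" using l(2) unfolding a_def g1_def g2_def .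
  qed (use gpos ab c in simp_all)
  have B: "dedekind_sum (m * h2 div g2) b = dedekind_sum (a * (m' * h)) b"
  proof (rule reduce [OF mult.commute])
    show "[l * h2 = h * (g1 * a)] (mod g2 * b)" using h(2) unfolding k .
    show "[l = g1\<^sup>2] (mod b)" using l(1) unfolding b_def g1_def g2_def .
  qed (use gpos ab c in simp_all)
  obtain z where z: "dedekind_sum (m' * h) (a * b) = dedekind_sum (b * (m' * h)) a + dedekind_sum (a * (m' * h)) b
      + of_int (m' * h * (a\<^sup>2 - 1) * (b\<^sup>2 - 1)) / (12 * of_int (a * b)) + 2 * of_int z"
    using dedekind_sum_mult_cong [of a b "m' * h"] c ab pos by auto
  \<comment> \<open>Numerator and denominator are extended by \<open>g1 * g2\<close>, which gives a
    denominator independent of \<open>m\<close> and permits summation over \<open>m\<close>.\<close>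
  have "real_of_int (m' * h * (a\<^sup>2 - 1) * (b\<^sup>2 - 1)) / (12 * of_int (a * b)) =
      of_int (h * (m * ((a\<^sup>2 - 1) * (b\<^sup>2 - 1)))) / (12 * of_int (k1 * k2))"
    using gpos ab unfolding k m by (simp add: field_simps)
  moreover have "m * h div (g1 * g2) = m' * h"
    using gpos unfolding m by (simp add: ac_simps)
  ultimately show ?thesis
    using z \<open>k1 * k2 div (g1 * g2) = a * b\<close>
    unfolding g A B g1_def [symmetric] g2_def [symmetric] a_def [symmetric] b_def [symmetric]
    by auto
qed

section \<open>Multiplicativity of the exponential sums\<close>

definition reduced_residues :: "int \<Rightarrow> int set" where
  "reduced_residues k = {h. 0 \<le> h \<and> h < k \<and> gcd h k = 1}"

text \<open>The Chinese remainder theorem, twisted by the units \<open>e1\<close> and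
  \<open>e2\<close>; it reindexes a sum over residues modulo \<open>k1 * k2\<close> as a double
  sum.\<close>

lemma bij_betw_reduced_residues:
  fixes k1 k2 e1 e2 :: int
  assumes "k1 > 0" "k2 > 0" "coprime k1 k2" "coprime e1 k1" "coprime e2 k2"
  shows "bij_betw (\<lambda>h. (e1 * h mod k1, e2 * h mod k2)) (reduced_residues (k1 * k2))
    (reduced_residues k1 \<times> reduced_residues k2)"
  unfolding bij_betw_def
proof (intro conjI equalityI subsetI)
  show "inj_on (\<lambda>h. (e1 * h mod k1, e2 * h mod k2)) (reduced_residues (k1 * k2))"
  proof (rule inj_onI)
    fix x y assume xy: "x \<in> reduced_residues (k1 * k2)" "y \<in> reduced_residues (k1 * k2)"
      "(e1 * x mod k1, e2 * x mod k2) = (e1 * y mod k1, e2 * y mod k2)"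
    then have "[e1 * x = e1 * y] (mod k1)" "[e2 * x = e2 * y] (mod k2)"
      by (simp_all add: cong_def)
    with assms have "[x = y] (mod k1 * k2)"
      by (simp add: cong_mult_lcancel coprime_cong_mult)
    with xy(1,2) show "x = y"
      by (simp add: reduced_residues_def cong_def)
  qed
next
  fix p assume "p \<in> (\<lambda>h. (e1 * h mod k1, e2 * h mod k2)) ` reduced_residues (k1 * k2)"
  with assms show "p \<in> reduced_residues k1 \<times> reduced_residues k2"
    by (auto simp: reduced_residues_def coprime_iff_gcd_eq_1 [symmetric])
next
  fix p assume "p \<in> reduced_residues k1 \<times> reduced_residues k2"
  then obtain x y where p: "p = (x, y)" "x \<in> reduced_residues k1" "y \<in> reduced_residues k2"
    by blast
  obtain d1 d2 where d: "[e1 * d1 = 1] (mod k1)" "[e2 * d2 = 1] (mod k2)"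
    using assms cong_solve_coprime_int by blast
  obtain h where h: "[h = d1 * x] (mod k1)" "[h = d2 * y] (mod k2)"
    using binary_chinese_remainder_int [OF assms(3)] by blast
  have "[e1 * h = x] (mod k1)"
    using cong_mult [OF cong_refl [of e1] h(1)] cong_mult [OF d(1) cong_refl [of x]]
    by (auto simp: mult.assoc intro: cong_trans)
  moreover have "[e2 * h = y] (mod k2)"
    using cong_mult [OF cong_refl [of e2] h(2)] cong_mult [OF d(2) cong_refl [of y]]
    by (auto simp: mult.assoc intro: cong_trans)
  moreover have "e1 * (h mod (k1 * k2)) mod k1 = e1 * h mod k1" "e2 * (h mod (k1 * k2)) mod k2 = e2 * h mod k2"
    by (metis mod_mod_cancel dvd_triv_left dvd_triv_right mod_mult_right_eq)+
  ultimately have hp: "(e1 * (h mod (k1 * k2)) mod k1, e2 * (h mod (k1 * k2)) mod k2) = p"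
    using p by (simp add: cong_def reduced_residues_def)
  have "coprime x k1" "coprime y k2"
    using p by (simp_all add: reduced_residues_def coprime_iff_gcd_eq_1)
  then have "coprime (e1 * h) k1" "coprime (e2 * h) k2"
    using \<open>[e1 * h = x] (mod k1)\<close> \<open>[e2 * h = y] (mod k2)\<close> cong_imp_coprime cong_sym by blast+
  then have "h mod (k1 * k2) \<in> reduced_residues (k1 * k2)"
    using assms(1,2)
    by (simp add: reduced_residues_def coprime_iff_gcd_eq_1 [symmetric] del: coprime_mult_right_iff) simp
  with hp show "p \<in> (\<lambda>h. (e1 * h mod k1, e2 * h mod k2)) ` reduced_residues (k1 * k2)"
    by force
qed

section \<open>The number \<open>u\<close> and the congruences for \<open>n1\<close> and
  \<open>n2\<close>\<close>

lemma u_sum_eq: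
  assumes "coprime k1 k2" "k1 > 0" "k2 > 0"
  shows "u_sum M \<delta> k1 k2 =
    - (\<Sum>m\<in>M. \<delta> m * (m * (((k1 div gcd m k1)\<^sup>2 - 1) * ((k2 div gcd m k2)\<^sup>2 - 1))))"
  unfolding u_sum_def sum_negf [symmetric]
proof (intro sum.cong refl)
  fix m
  \<comment> \<open>Multiplicativity of the gcd gives the bracket the form
    \<open>x + y - x * y - 1 = - (x - 1) * (y - 1)\<close>.\<close>
  have "(k1 * k2)\<^sup>2 div (gcd m (k1 * k2))\<^sup>2 = (k1 div gcd m k1)\<^sup>2 * (k2 div gcd m k2)\<^sup>2"
    unfolding gcd_mult_coprime [OF assms(1)] power_mult_distrib
    by (subst div_mult_div_if_dvd [symmetric]) (simp_all add: div_power)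
  moreover have "k1\<^sup>2 div (gcd m k1)\<^sup>2 = (k1 div gcd m k1)\<^sup>2" "k2\<^sup>2 div (gcd m k2)\<^sup>2 = (k2 div gcd m k2)\<^sup>2"
    by (simp_all add: div_power)
  ultimately show "m * \<delta> m * (k1\<^sup>2 div (gcd m k1)\<^sup>2 + k2\<^sup>2 div (gcd m k2)\<^sup>2 - (k1 * k2)\<^sup>2 div (gcd m (k1 * k2))\<^sup>2 - 1) =
    - (\<delta> m * (m * (((k1 div gcd m k1)\<^sup>2 - 1) * ((k2 div gcd m k2)\<^sup>2 - 1))))"
    by (simp add: algebra_simps)
qed

lemma twenty_four_dvd_u_sum:
  assumes "coprime k1 k2" "k1 > 0" "k2 > 0"
  shows "24 dvd u_sum M \<delta> k1 k2"
proof -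
  have quotient_dvd: "q div gcd m q dvd q" for m q :: int
    by (rule dvdI [of _ _ "gcd m q"]) simp
  have "coprime (k1 div gcd m k1) (k2 div gcd m k2)" for m
    by (rule coprime_divisors [OF quotient_dvd quotient_dvd assms(1)])
  then have "24 dvd \<delta> m * (m * (((k1 div gcd m k1)\<^sup>2 - 1) * ((k2 div gcd m k2)\<^sup>2 - 1)))" for m
    by (rule dvd_mult [OF dvd_mult, OF twenty_four_dvd])
  then show ?thesis
    unfolding u_sum_eq [OF assms] dvd_minus_iff by (intro dvd_sum)
qed

text \<open>The factor \<open>t\<close> of 24 cancels against the modulus, and its cofactor
  \<open>t'\<close> is a unit modulo \<open>k\<close>.\<close>

lemma cong_cancel_factor_24:
  fixes x y t t' k :: int
  assumes "t * t' = 24" "t > 0" "coprime t' k"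
  shows "[24 * x = 24 * y] (mod t * k) \<longleftrightarrow> [x = y] (mod k)"
proof -
  have "[24 * x = 24 * y] (mod t * k) \<longleftrightarrow> t * k dvd t * (t' * (x - y))"
    by (simp add: cong_iff_dvd_diff assms(1) [symmetric] algebra_simps)
  also have "\<dots> \<longleftrightarrow> k dvd x - y"
    using assms by (simp add: coprime_commute coprime_dvd_mult_right_iff)
  finally show ?thesis by (simp add: cong_iff_dvd_diff)
qed

lemma cong_reduce_u_sum:
  fixes l n v N q t t' k :: int
  assumes "u = - (24 * v)" "t * t' = 24" "t > 0" "coprime t' k"
  shows "[l * (24 * n - u) = 24 * N * q\<^sup>2] (mod (t * k)) \<longleftrightarrow> [l * (n + v) = N * q\<^sup>2] (mod k)"
proof -
  have "l * (24 * n - u) = 24 * (l * (n + v))"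
    by (simp add: assms(1) algebra_simps)
  then show ?thesis
    unfolding mult.assoc [of 24 N] by (simp only: cong_cancel_factor_24 [OF assms(2-4)])
qed

section \<open>Splitting the exponents modulo 1 and reindexing\<close>

lemma exp_shift_int:
  fixes x :: real
  shows "exp (- 2 * complex_of_real pi * \<i> * complex_of_real (x + of_int z)) =
    exp (- 2 * complex_of_real pi * \<i> * complex_of_real x)"
proof -
  have *: "exp (- 2 * complex_of_real pi * \<i> * complex_of_real y) = cis (- (2 * pi * y))" for y
    by (simp add: cis_conv_exp ac_simps)
  have "- (2 * pi * (x + of_int z)) = - (2 * pi * x) + 2 * pi * of_int (- z)"
    by (simp add: algebra_simps)
  then show ?thesis
    unfolding * by (simp only: cis_mult [symmetric] cis_multiple_2pi [OF Ints_of_int]) simp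
qed

definition phase :: "int set \<Rightarrow> (int \<Rightarrow> int) \<Rightarrow> int \<Rightarrow> int \<Rightarrow> int \<Rightarrow> real" where
  "phase M \<delta> k n h = of_int (h * n) / of_int k +
     1 / 2 * (\<Sum>m\<in>M. of_int (\<delta> m) * dedekind_sum (m * h div gcd m k) (k div gcd m k))"

text \<open>Half of the correction terms add up to \<open>h * v / (k1 * k2)\<close>, so
  \<open>n\<close> is effectively replaced by \<open>n + v\<close>. The resulting fraction splits by
  partial fractions modulo 1, and the even integers, once halved, do no harm.\<close>

lemma phase_split:
  fixes k1 k2 h h1 h2 l n n1 n2 v :: int
  assumes M: "\<And>m. m \<in> M \<Longrightarrow> m > 0"
    and pos: "k1 > 0" "k2 > 0" "h > 0"
    and cop: "coprime k1 k2" "coprime h (k1 * k2)" "coprime l (k1 * k2)"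
    and l: "\<And>m. m \<in> M \<Longrightarrow> [l = (gcd m k1)\<^sup>2] (mod (k2 div gcd m k2))"
      "\<And>m. m \<in> M \<Longrightarrow> [l = (gcd m k2)\<^sup>2] (mod (k1 div gcd m k1))"
    and h: "[l * h1 = h * k2] (mod k1)" "[l * h2 = h * k1] (mod k2)"
    and v: "u_sum M \<delta> k1 k2 = - (24 * v)"
    and n: "[l * (n + v) = n1 * k2\<^sup>2] (mod k1)" "[l * (n + v) = n2 * k1\<^sup>2] (mod k2)"
  shows "\<exists>z. phase M \<delta> (k1 * k2) n h = phase M \<delta> k1 n1 h1 + phase M \<delta> k2 n2 h2 + of_int z"
proof -
  define E where "E m = m * (((k1 div gcd m k1)\<^sup>2 - 1) * ((k2 div gcd m k2)\<^sup>2 - 1))" for m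
  define s where "s k h m = dedekind_sum (m * h div gcd m k) (k div gcd m k)" for k h m
  have "\<forall>m\<in>M. \<exists>z. s (k1 * k2) h m = s k1 h1 m + s k2 h2 m + of_int (h * E m) / (12 * of_int (k1 * k2)) + 2 * of_int z"
    unfolding s_def E_def by (intro ballI dedekind_sum_split [OF _ pos cop(1,2) _ _ h] M l)
  then obtain z where z: "s (k1 * k2) h m =
      s k1 h1 m + s k2 h2 m + of_int (h * E m) / (12 * of_int (k1 * k2)) + 2 * of_int (z m)" if "m \<in> M" for m
    by metis
  have "(\<Sum>m\<in>M. of_int (\<delta> m) * s (k1 * k2) h m) =
    (\<Sum>m\<in>M. of_int (\<delta> m) * s k1 h1 m + of_int (\<delta> m) * s k2 h2 m
      + of_int h / (12 * of_int (k1 * k2)) * of_int (\<delta> m * E m) + 2 * of_int (\<delta> m * z m))"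
    by (intro sum.cong refl) (simp add: z algebra_simps)
  also have "\<dots> = (\<Sum>m\<in>M. of_int (\<delta> m) * s k1 h1 m) + (\<Sum>m\<in>M. of_int (\<delta> m) * s k2 h2 m)
      + of_int h / (12 * of_int (k1 * k2)) * of_int (\<Sum>m\<in>M. \<delta> m * E m) + 2 * of_int (\<Sum>m\<in>M. \<delta> m * z m)"
    by (simp only: sum.distrib sum_distrib_left of_int_sum)
  also have "(\<Sum>m\<in>M. \<delta> m * E m) = 24 * v"
    using v unfolding u_sum_eq [OF cop(1) pos(1,2)] E_def by simp
  finally have sum: "(\<Sum>m\<in>M. of_int (\<delta> m) * s (k1 * k2) h m) =
      (\<Sum>m\<in>M. of_int (\<delta> m) * s k1 h1 m) + (\<Sum>m\<in>M. of_int (\<delta> m) * s k2 h2 m)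
      + of_int h / (12 * of_int (k1 * k2)) * of_int (24 * v) + 2 * of_int (\<Sum>m\<in>M. \<delta> m * z m)" .
  \<comment> \<open>After multiplication by the unit \<open>l * q\<close> the claim is a linear
    combination of the two congruences.\<close>
  have key: "p dvd h * (n + v) - x * N * q"
    if "coprime l p" "coprime q p" "[l * x = h * q] (mod p)" "[l * (n + v) = N * q\<^sup>2] (mod p)" for p q x N
  proof -
    have "p dvd h * q * (l * (n + v) - N * q\<^sup>2) - q * N * q * (l * x - h * q)"
      using that(3,4) unfolding cong_iff_dvd_diff by (rule dvd_diff [OF dvd_mult dvd_mult, rotated])
    also have "\<dots> = l * q * (h * (n + v) - x * N * q)"
      by (simp add: algebra_simps power2_eq_square)
    finally show ?thesis
      using that by (simp add: coprime_commute coprime_dvd_mult_right_iff)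
  qed
  have "k1 dvd h * (n + v) - h1 * n1 * k2 - h2 * n2 * k1"
    using key [of k1 k2 h1 n1] h n cop by (simp add: coprime_commute)
  moreover have "k2 dvd h * (n + v) - h2 * n2 * k1 - h1 * n1 * k2"
    using key [of k2 k1 h2 n2] h n cop by (simp add: coprime_commute)
  ultimately have "k1 * k2 dvd h * (n + v) - h1 * n1 * k2 - h2 * n2 * k1"
    using cop(1) by (intro divides_mult) (simp_all add: algebra_simps)
  then obtain w where "h * (n + v) - h1 * n1 * k2 - h2 * n2 * k1 = k1 * k2 * w" ..
  then have "h * (n + v) = h1 * n1 * k2 + h2 * n2 * k1 + k1 * k2 * w"
    by linarith
  then have "real_of_int (h * (n + v)) = of_int (h1 * n1 * k2 + h2 * n2 * k1 + k1 * k2 * w)"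
    by (simp only:)
  then have "real_of_int (h * n) / of_int (k1 * k2) + of_int h / (24 * of_int (k1 * k2)) * of_int (24 * v) =
      of_int (h1 * n1) / of_int k1 + of_int (h2 * n2) / of_int k2 + of_int w"
    using pos by (simp add: field_simps)
  with sum show ?thesis
    unfolding phase_def s_def [symmetric]
    by (intro exI [of _ "w + (\<Sum>m\<in>M. \<delta> m * z m)"]) (simp add: algebra_simps)
qed

lemma A_sum_eq:
  "A_sum M \<delta> k n = (\<Sum>h\<in>reduced_residues k. exp (- 2 * complex_of_real pi * \<i> * complex_of_real (phase M \<delta> k n h)))"
  by (simp add: A_sum_def reduced_residues_def phase_def)

lemma A_sum_mult:
  fixes k1 k2 l n n1 n2 v :: int
  assumes M: "\<And>m. m \<in> M \<Longrightarrow> m > 0"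
    and pos: "k1 > 1" "k2 > 1"
    and cop: "coprime k1 k2" "coprime l (k1 * k2)"
    and l: "\<And>m. m \<in> M \<Longrightarrow> [l = (gcd m k1)\<^sup>2] (mod (k2 div gcd m k2))"
      "\<And>m. m \<in> M \<Longrightarrow> [l = (gcd m k2)\<^sup>2] (mod (k1 div gcd m k1))"
    and v: "u_sum M \<delta> k1 k2 = - (24 * v)"
    and n: "[l * (n + v) = n1 * k2\<^sup>2] (mod k1)" "[l * (n + v) = n2 * k1\<^sup>2] (mod k2)"
  shows "A_sum M \<delta> (k1 * k2) n = A_sum M \<delta> k1 n1 * A_sum M \<delta> k2 n2"
proof -
  define e where "e x = exp (- 2 * complex_of_real pi * \<i> * complex_of_real x)" for x
  have e_add: "e (x + y) = e x * e y" for x y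
    by (simp only: e_def of_real_add distrib_left exp_add)
  \<comment> \<open>The inverse \<open>w\<close> of \<open>l\<close> provides explicit
    \<open>h1\<close> and \<open>h2\<close>, namely the residues of \<open>w * k2 * h\<close> and
    \<open>w * k1 * h\<close>.\<close>
  obtain w where w: "[l * w = 1] (mod k1 * k2)"
    using cop(2) cong_solve_coprime_int by blast
  then have w12: "[l * w = 1] (mod k1)" "[l * w = 1] (mod k2)"
    by (auto intro: cong_dvd_modulus)
  have "coprime w k1" "coprime w k2"
    using w12 by (metis coprime_iff_invertible_int mult.commute)+
  then have bij: "bij_betw (\<lambda>h. (w * k2 * h mod k1, w * k1 * h mod k2)) (reduced_residues (k1 * k2))
      (reduced_residues k1 \<times> reduced_residues k2)"
    using pos cop by (intro bij_betw_reduced_residues) (simp_all add: coprime_commute)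
  have eq: "e (phase M \<delta> (k1 * k2) n h) =
      e (phase M \<delta> k1 n1 (w * k2 * h mod k1)) * e (phase M \<delta> k2 n2 (w * k1 * h mod k2))"
    if "h \<in> reduced_residues (k1 * k2)" for h
  proof -
    \<comment> \<open>Reciprocity is applied to a positive multiple of \<open>h\<close>. The residue
      0 does not occur, since it is not coprime to a modulus above 1.\<close>
    have "h \<noteq> 0"
      using that pos by (auto simp: reduced_residues_def zmult_eq_1_iff)
    then have h: "h > 0" "coprime h (k1 * k2)"
      using that by (auto simp: reduced_residues_def coprime_iff_gcd_eq_1)
    have inv: "[l * (w * q * h mod p) = h * q] (mod p)" if "[l * w = 1] (mod p)" for p q
    proof -
      have "[l * (w * q * h mod p) = l * w * (h * q)] (mod p)"
        by (simp add: cong_def mod_mult_right_eq ac_simps)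
      also have "[l * w * (h * q) = 1 * (h * q)] (mod p)"
        using that by (rule cong_scalar_right)
      finally show ?thesis by simp
    qed
    obtain z where "phase M \<delta> (k1 * k2) n h =
        phase M \<delta> k1 n1 (w * k2 * h mod k1) + phase M \<delta> k2 n2 (w * k1 * h mod k2) + of_int z"
      using phase_split [of M k1 k2 h l "w * k2 * h mod k1" "w * k1 * h mod k2" \<delta> v n n1 n2]
        assms h inv [OF w12(1)] inv [OF w12(2)] by auto
    then show ?thesis
      using exp_shift_int by (simp only: e_add [symmetric]) (simp only: e_def)
  qed
  have "A_sum M \<delta> (k1 * k2) n = (\<Sum>h\<in>reduced_residues (k1 * k2). e (phase M \<delta> (k1 * k2) n h))"
    by (simp only: A_sum_eq e_def)
  also have "\<dots> = (\<Sum>h\<in>reduced_residues (k1 * k2). (\<lambda>(x, y). e (phase M \<delta> k1 n1 x) * e (phase M \<delta> k2 n2 y))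
      (w * k2 * h mod k1, w * k1 * h mod k2))"
    by (intro sum.cong refl) (simp add: eq)
  also have "\<dots> = (\<Sum>(x, y)\<in>reduced_residues k1 \<times> reduced_residues k2. e (phase M \<delta> k1 n1 x) * e (phase M \<delta> k2 n2 y))"
    by (rule sum.reindex_bij_betw [OF bij])
  also have "\<dots> = (\<Sum>x\<in>reduced_residues k1. e (phase M \<delta> k1 n1 x)) * (\<Sum>y\<in>reduced_residues k2. e (phase M \<delta> k2 n2 y))"
    by (simp only: sum_product sum.cartesian_product)
  also have "\<dots> = A_sum M \<delta> k1 n1 * A_sum M \<delta> k2 n2"
    by (simp only: A_sum_eq e_def)
  finally show ?thesis .
qed

section \<open>Existence of solutions and the final assembly\<close>

lemma exists_pos_cong_solution:
  fixes a b k :: int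
  assumes "coprime a k" "k > 0"
  shows "\<exists>x>0. [b = x * a] (mod k)"
proof -
  obtain y where y: "[a * y = 1] (mod k)"
    using cong_solve_coprime_int [OF assms(1)] by blast
  \<comment> \<open>The residue itself may be 0; adding \<open>k\<close> makes the solution
    positive.\<close>
  define x where "x = b * y mod k + k"
  have "0 \<le> b * y mod k"
    using assms(2) by (rule pos_mod_sign)
  with assms(2) have "x > 0"
    unfolding x_def by (rule add_nonneg_pos [rotated])
  have "[x * a = b * y * a] (mod k)"
    unfolding x_def by (rule cong_scalar_right) (simp add: cong_def)
  also have "b * y * a = b * (a * y)"
    by (simp only: ac_simps)
  also have "[b * (a * y) = b * 1] (mod k)"
    using y by (rule cong_scalar_left)
  finally have "[b = x * a] (mod k)"
    unfolding mult_1_right by (rule cong_sym)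
  with \<open>x > 0\<close> show ?thesis by blast
qed

lemma exists_solutions:
  fixes k1 k2 l n \<theta>1 \<theta>2 :: int
  assumes "k1 > 1" "k2 > 1" "coprime k1 k2"
    and "\<theta>1 > 0" "\<theta>2 > 0" "\<theta>1 * \<theta>2 = 24" "coprime \<theta>2 k1" "coprime \<theta>1 k2"
  shows "\<exists>n1 n2. n1 > 0 \<and> n2 > 0 \<and>
    [l * (24 * n - u_sum M \<delta> k1 k2) = 24 * n1 * k2\<^sup>2] (mod (\<theta>1 * k1)) \<and>
    [l * (24 * n - u_sum M \<delta> k1 k2) = 24 * n2 * k1\<^sup>2] (mod (\<theta>2 * k2))"
proof -
  have pos: "k1 > 0" "k2 > 0" using assms(1,2) by simp_all
  obtain w where "u_sum M \<delta> k1 k2 = 24 * w"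
    using twenty_four_dvd_u_sum [OF assms(3) pos] ..
  then have v: "u_sum M \<delta> k1 k2 = - (24 * (- w))" by simp
  have "\<theta>2 * \<theta>1 = 24" using assms(6) by (simp add: mult.commute)
  note iff = cong_reduce_u_sum [OF v assms(6,4,7)] cong_reduce_u_sum [OF v this assms(5,8)]
  have "coprime (k2\<^sup>2) k1" "coprime (k1\<^sup>2) k2"
    using assms(3) by (simp_all add: coprime_commute)
  with exists_pos_cong_solution pos show ?thesis
    unfolding iff by meson
qed

lemma A_sum_product:
  fixes k1 k2 l n n1 n2 \<theta>1 \<theta>2 :: int
  assumes "\<forall>m\<in>M. m > 0" "k1 > 1" "k2 > 1" "coprime k1 k2" "coprime l (k1 * k2)"
    and "\<forall>m\<in>M. [l = (gcd m k1)\<^sup>2] (mod (k2 div gcd m k2))"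
    and "\<forall>m\<in>M. [l = (gcd m k2)\<^sup>2] (mod (k1 div gcd m k1))"
    and "\<theta>1 > 0" "\<theta>2 > 0" "\<theta>1 * \<theta>2 = 24" "coprime \<theta>2 k1" "coprime \<theta>1 k2"
    and "[l * (24 * n - u_sum M \<delta> k1 k2) = 24 * n1 * k2\<^sup>2] (mod (\<theta>1 * k1))"
    and "[l * (24 * n - u_sum M \<delta> k1 k2) = 24 * n2 * k1\<^sup>2] (mod (\<theta>2 * k2))"
  shows "A_sum M \<delta> (k1 * k2) n = A_sum M \<delta> k1 n1 * A_sum M \<delta> k2 n2"
proof -
  have pos: "k1 > 0" "k2 > 0" using assms(2,3) by simp_all
  obtain w where "u_sum M \<delta> k1 k2 = 24 * w"
    using twenty_four_dvd_u_sum [OF assms(4) pos] ..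
  then have v: "u_sum M \<delta> k1 k2 = - (24 * (- w))" by simp
  have "\<theta>2 * \<theta>1 = 24" using assms(10) by (simp add: mult.commute)
  note iff = cong_reduce_u_sum [OF v assms(10,8,11)] cong_reduce_u_sum [OF v this assms(9,12)]
  show ?thesis
    using assms(1,6,7) by (intro A_sum_mult [OF _ assms(2-5) _ _ v assms(13,14) [unfolded iff]]) blast+
qed

theorem theorem5p1:
  fixes M :: "int set" and \<delta> :: "int \<Rightarrow> int" and k1 k2 k l \<theta>1 \<theta>2 n :: int
  assumes "finite M" and "\<forall>m\<in>M. m > 0"
    and "k1 > 1" and "k2 > 1" and "coprime k1 k2" and "k = k1 * k2"
    and "l > 0" and "gcd l k = 1"
    and "\<forall>m\<in>M. [l = (gcd m k1)\<^sup>2] (mod (k2 div gcd m k2))"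
    and "\<forall>m\<in>M. [l = (gcd m k2)\<^sup>2] (mod (k1 div gcd m k1))"
    and "\<theta>1 > 0" and "\<theta>2 > 0" and "\<theta>1 * \<theta>2 = 24" and "gcd (\<theta>1 * k1) (\<theta>2 * k2) = 1"
  shows "(\<exists>n1 n2. n1 > 0 \<and> n2 > 0 \<and>
            [l * (24 * n - u_sum M \<delta> k1 k2) = 24 * n1 * k2\<^sup>2] (mod (\<theta>1 * k1)) \<and>
            [l * (24 * n - u_sum M \<delta> k1 k2) = 24 * n2 * k1\<^sup>2] (mod (\<theta>2 * k2)))
       \<and> (\<forall>n1 n2. n1 > 0 \<and> n2 > 0 \<and>
            [l * (24 * n - u_sum M \<delta> k1 k2) = 24 * n1 * k2\<^sup>2] (mod (\<theta>1 * k1)) \<and>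
            [l * (24 * n - u_sum M \<delta> k1 k2) = 24 * n2 * k1\<^sup>2] (mod (\<theta>2 * k2))
            \<longrightarrow> A_sum M \<delta> k n = A_sum M \<delta> k1 n1 * A_sum M \<delta> k2 n2)"
proof -
  have l: "coprime l (k1 * k2)" and "coprime (\<theta>1 * k1) (\<theta>2 * k2)"
    using assms(6,8,14) by (simp_all only: coprime_iff_gcd_eq_1)
  \<comment> \<open>In each congruence the cofactor of \<open>\<theta>1\<close> or
    \<open>\<theta>2\<close> in 24 is thus a unit modulo \<open>k1\<close> or \<open>k2\<close>, as
    the removal of 24 requires.\<close>
  then have cop: "coprime \<theta>2 k1" "coprime \<theta>1 k2"
    by (simp_all add: coprime_commute)
  show ?thesis
    using exists_solutions [OF assms(3-5,11-13) cop]
      A_sum_product [OF assms(2-5) l assms(9-13) cop] unfolding assms(6) by blast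
qed

end
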